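(* Let $f,g:\mathbb{R}^n\to\mathbb{R}$ be polynomials of degree $k\ge 1$, written as $f(x)=f_0+f_1x+\cdots+f_kx^k$ and $g(x)=g_0+g_1x+\cdots+g_kx^k$, where $f_i,g_i\in\mathbb{R}^{n^i}$ are constant row vectors, $i=0,1,\dots,k$. Define the homogeneous functions $\tilde f,\tilde g:\mathbb{R}^{n+1}\to\mathbb{R}$ by $$\tilde f(x,t)=f_0t^k+f_1xt^{k-1}+\cdots+f_kx^k,\qquad \tilde g(x,t)=g_0t^k+g_1xt^{k-1}+\cdots+g_kx^k .$$ Assume that $\tilde f$ is copositive with $\tilde g$, that $\tilde f$ and $\tilde g$ have no common zero point except $0\in\mathbb{R}^{n+1}$, and that there exists at most one vector $(a,b)\in\mathbb{R}^2$ such that $a^2+b^2=1$, $a+\delta(a)b>0$, and both of the systems $\{\tilde f(x,t)=a,\ \tilde g(x,t)=b\}$ and $\{\tilde f(x,t)=-a,\ \tilde g(x,t)=-b\}$ have a solution $(x,t)\in\mathbb{R}^{n+1}$, where $\delta(s)=1$ if $s=0$ and $\delta(s)=0$ if $s\ne 0$. Then there exists $\xi\ge 0$ such that $f(x)-\xi g(x)\ge 0$ for all $x\in\mathbb{R}^n$.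
   Context: For a column vector $x\in\mathbb{R}^n$, $x^i\in\mathbb{R}^{n^i}$ denotes the $i$-fold semi-tensor (Kronecker) power $x\ltimes\cdots\ltimes x$, where $u\ltimes v=(u_1v^T,\dots,u_nv^T)^T$. Thus $f_ix^i$ is the homogeneous part of degree $i$ of the polynomial $f$ (and similarly for $g$), and $\tilde f,\tilde g$ are the degree-$k$ homogenizations of $f,g$ with the extra variable $t\in\mathbb{R}$. A function $F:\mathbb{R}^m\to\mathbb{R}$ is copositive with $G:\mathbb{R}^m\to\mathbb{R}$ if $G(y)\ge 0$ implies $F(y)\ge 0$. *)

theory Defs
  imports Complex_Main "Jordan_Normal_Form.Matrix"
begin

text \<open>The Euclidean space of dimension \<open>n\<close> is \<open>carrier_vec n\<close>; the space of dimension
  \<open>n + 1\<close> is identified with \<open>carrier_vec n \<times> UNIV\<close>, whose elements are the pairs \<open>(x, t)\<close>.\<close>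

text \<open>\<open>u \<ltimes> v\<close> stacks the blocks \<open>u\<^sub>1 v, u\<^sub>2 v, \<dots>\<close>, so (counting from 0) entry
  \<open>l\<close> lies in block \<open>l div dim_vec v\<close> at position \<open>l mod dim_vec v\<close>.\<close>

definition semi_tensor :: "real Matrix.vec \<Rightarrow> real Matrix.vec \<Rightarrow> real Matrix.vec" where
  "semi_tensor u v =
    Matrix.vec (dim_vec u * dim_vec v)
      (\<lambda>l. vec_index u (l div dim_vec v) * vec_index v (l mod dim_vec v))"

primrec semi_tensor_power :: "real Matrix.vec \<Rightarrow> nat \<Rightarrow> real Matrix.vec" where
  "semi_tensor_power x 0 = Matrix.vec 1 (\<lambda>_. 1)"
| "semi_tensor_power x (Suc i) = semi_tensor (semi_tensor_power x i) x"

definition homogeneous_part :: "(nat \<Rightarrow> real Matrix.vec) \<Rightarrow> nat \<Rightarrow> real Matrix.vec \<Rightarrow> real" where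
  "homogeneous_part c i x = scalar_prod (c i) (semi_tensor_power x i)"

definition polynomial_fun :: "nat \<Rightarrow> (nat \<Rightarrow> real Matrix.vec) \<Rightarrow> real Matrix.vec \<Rightarrow> real" where
  "polynomial_fun k c x = (\<Sum>i\<le>k. homogeneous_part c i x)"

text \<open>The coefficient vectors are not unique: distinct entries of the \<open>i\<close>-th power of \<open>x\<close>
  may be the same monomial (\<open>x\<^sub>1 x\<^sub>2\<close> and \<open>x\<^sub>2 x\<^sub>1\<close>), so \<open>c k\<close> can be nonzero although
  the part of degree \<open>k\<close> vanishes. Having degree \<open>k\<close> therefore means that the homogeneous part
  itself, not merely \<open>c k\<close>, is nonzero.\<close>

definition coeffs_of_degree :: "nat \<Rightarrow> nat \<Rightarrow> (nat \<Rightarrow> real Matrix.vec) \<Rightarrow> bool" where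
  "coeffs_of_degree n k c \<longleftrightarrow>
    (\<forall>i\<le>k. c i \<in> carrier_vec (n ^ i)) \<and>
    (\<exists>x\<in>carrier_vec n. homogeneous_part c k x \<noteq> 0)"

definition homogenization ::
    "nat \<Rightarrow> (nat \<Rightarrow> real Matrix.vec) \<Rightarrow> real Matrix.vec \<times> real \<Rightarrow> real" where
  "homogenization k c = (\<lambda>(x, t). \<Sum>i\<le>k. homogeneous_part c i x * t ^ (k - i))"

definition copositive_with :: "'a set \<Rightarrow> ('a \<Rightarrow> real) \<Rightarrow> ('a \<Rightarrow> real) \<Rightarrow> bool" where
  "copositive_with D F G \<longleftrightarrow> (\<forall>y\<in>D. G y \<ge> 0 \<longrightarrow> F y \<ge> 0)"

definition delta :: "real \<Rightarrow> real" where
  "delta s = (if s = 0 then 1 else 0)"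

end

theory Submission
  imports Defs "HOL-Analysis.Function_Topology"
begin

text \<open>The two homogenizations map a line through the origin into a line through the origin of
  the plane, so only the slope \<open>F / G\<close> of an image point and the sign of \<open>G\<close> matter, where
  \<open>F\<close> and \<open>G\<close> are the homogenizations of the two polynomials. A number \<open>\<xi> \<ge> 0\<close> satisfies
  \<open>F - \<xi> G \<ge> 0\<close> everywhere exactly if it is at least every slope attained with \<open>G < 0\<close> and at
  most every slope attained with \<open>G > 0\<close>; copositivity makes the latter slopes nonnegative, and
  where \<open>G = 0\<close> it gives \<open>F \<ge> 0\<close>.

  The slopes are ordered correctly (\<open>slope_neg_le_slope_pos\<close>): if a point \<open>p\<close> with
  \<open>G p < 0\<close> had a larger slope than a point \<open>q\<close> with \<open>G q > 0\<close>, then for every \<open>c\<close> strictly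
  between the two slopes the segment from \<open>p\<close> to \<open>q\<close> would cross the line of slope \<open>c\<close> once with
  \<open>G < 0\<close> and once with \<open>G > 0\<close>. This is a connectedness argument: the segment avoids the origin,
  and where \<open>G\<close> vanishes away from the origin, \<open>F\<close> is positive. So both \<open>\<plusminus>(c, 1)\<close> would be
  directions of image points, for infinitely many \<open>c\<close>, whereas at most one antipodal pair of
  directions occurs.

  It remains to bound the slopes with \<open>G < 0\<close> when no point has \<open>G > 0\<close>. Only those
  with \<open>F \<le> 0\<close> matter, the others being negative. By homogeneity they are the slopes of the points of
  a sphere with \<open>F \<le> 0\<close> and \<open>G \<le> 0\<close>. These points form a compact set on which \<open>G\<close> does not vanish,
  because \<open>F > 0\<close> at the zeros of \<open>G\<close>. So \<open>F / G\<close> attains a maximum there unless the set is empty,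
  and this maximum, or \<open>0\<close> for the empty set, serves as \<open>\<xi>\<close> in all cases.\<close>

section \<open>Copositive pairs of homogeneous functions\<close>

text \<open>Points of the \<open>(n + 1)\<close>-dimensional space are encoded as sequences vanishing beyond index \<open>n\<close>,
  so that spheres of every dimension are subsets of one product space and compact by Tychonoff's
  theorem. The last assumption expresses in terms of slopes that at most one antipodal pair of
  directions occurs; positive slopes suffice because the argument looks strictly above a slope with
  \<open>G > 0\<close>, which copositivity makes nonnegative.\<close>

locale copositive_homogeneous_pair =
  fixes n k :: nat and F G :: "(nat \<Rightarrow> real) \<Rightarrow> real" and D :: "(nat \<Rightarrow> real) set"
  assumes D_def: "D = {w. \<forall>i>n. w i = 0}"
    and k: "k \<ge> 1"
    and F_scale: "F (\<lambda>i. r * w i) = r ^ k * F w"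
    and G_scale: "G (\<lambda>i. r * w i) = r ^ k * G w"
    and F_cont: "continuous_on UNIV F"
    and G_cont: "continuous_on UNIV G"
    and copositive: "w \<in> D \<Longrightarrow> G w \<ge> 0 \<Longrightarrow> F w \<ge> 0"
    and no_common_zero: "w \<in> D \<Longrightarrow> F w = 0 \<Longrightarrow> G w = 0 \<Longrightarrow> w = (\<lambda>_. 0)"
    and antipodal_slope_unique:
      "\<lbrakk>c > 0; d > 0;
        \<exists>w\<in>D. G w > 0 \<and> F w = c * G w; \<exists>w\<in>D. G w < 0 \<and> F w = c * G w;
        \<exists>w\<in>D. G w > 0 \<and> F w = d * G w; \<exists>w\<in>D. G w < 0 \<and> F w = d * G w\<rbrakk> \<Longrightarrow> c = d"
begin

lemma G_zero: "G (\<lambda>_. 0) = 0"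
  using G_scale[of 0 "\<lambda>_. 0"] k by (simp add: power_0_left)

lemma F_zero: "F (\<lambda>_. 0) = 0"
  using F_scale[of 0 "\<lambda>_. 0"] k by (simp add: power_0_left)

lemma F_pos_where_G_zero:
  assumes "w \<in> D" "w \<noteq> (\<lambda>_. 0)" "G w = 0"
  shows "F w > 0"
  using copositive[of w] no_common_zero[of w] assms by force

text \<open>Two points whose segment passes through the origin lie on one line through it, so their
  slopes agree, whatever the parity of \<open>k\<close>.\<close>

lemma segment_avoids_origin:
  assumes "G p \<noteq> 0" "G q \<noteq> 0" "F p / G p \<noteq> F q / G q"
  shows "(\<lambda>i. (1 - s) * p i + s * q i) \<noteq> (\<lambda>_. 0)"
proof
  assume eq: "(\<lambda>i. (1 - s) * p i + s * q i) = (\<lambda>_. 0)"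
  have zero: "(1 - s) * p i + s * q i = 0" for i
    using fun_cong[OF eq, of i] .
  have "s \<noteq> 1"
  proof
    assume "s = 1"
    then have "q = (\<lambda>_. 0)" using zero by (simp add: fun_eq_iff)
    then show False using G_zero assms by simp
  qed
  define r where "r = - s / (1 - s)"
  have "p i = r * q i" for i
    using zero[of i] \<open>s \<noteq> 1\<close> by (simp add: r_def field_simps)
  then have p: "p = (\<lambda>i. r * q i)" by blast
  have "F p = r ^ k * F q" "G p = r ^ k * G q"
    unfolding p by (rule F_scale G_scale)+
  moreover from this have "r ^ k \<noteq> 0" using assms(1) by auto
  ultimately have "F p / G p = F q / G q"
    by (metis mult_divide_mult_cancel_left)
  then show False using assms(3) by simp
qed

text \<open>The two crossings are zeros of \<open>max G (F - c G)\<close> and \<open>max (- G) (F - c G)\<close> along the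
  segment: at such a zero \<open>G\<close> itself cannot vanish, since then \<open>F - c G = F\<close> would be positive,
  so the zero comes from \<open>F - c G\<close> and the sign of \<open>G\<close> is determined.\<close>

lemma slope_attained_on_both_sides:
  assumes pD: "p \<in> D" and qD: "q \<in> D" and Gp: "G p < 0" and Gq: "G q > 0"
    and c: "F q / G q < c" "c < F p / G p"
  shows "\<exists>w\<in>D. G w > 0 \<and> F w = c * G w" and "\<exists>w\<in>D. G w < 0 \<and> F w = c * G w"
proof -
  define \<gamma> where "\<gamma> s = (\<lambda>i. (1 - s) * p i + s * q i)" for s :: real
  define h where "h w = F w - c * G w" for w
  have \<gamma>D: "\<gamma> s \<in> D" for s
    using pD qD by (simp add: \<gamma>_def D_def)
  have \<gamma>0: "\<gamma> 0 = p" and \<gamma>1: "\<gamma> 1 = q"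
    by (simp_all add: \<gamma>_def)
  have \<gamma>_nz: "\<gamma> s \<noteq> (\<lambda>_. 0)" for s
    unfolding \<gamma>_def by (rule segment_avoids_origin) (use Gp Gq c in auto)
  have h_pos: "h (\<gamma> s) > 0" if "G (\<gamma> s) = 0" for s
    using F_pos_where_G_zero[OF \<gamma>D \<gamma>_nz that] that by (simp add: h_def)
  have hp: "h p < 0" and hq: "h q < 0"
    using c Gp Gq by (simp_all add: h_def field_simps)
  have \<gamma>_cont: "continuous_on {0..1} \<gamma>"
    unfolding \<gamma>_def by (intro continuous_on_coordinatewise_then_product continuous_intros)
  have G\<gamma>: "continuous_on {0..1} (\<lambda>s. G (\<gamma> s))" and F\<gamma>: "continuous_on {0..1} (\<lambda>s. F (\<gamma> s))"
    by (rule continuous_on_compose2[OF _ \<gamma>_cont], rule G_cont F_cont, simp)+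
  have h\<gamma>: "continuous_on {0..1} (\<lambda>s. h (\<gamma> s))"
    unfolding h_def by (intro continuous_intros G\<gamma> F\<gamma>)
  have "\<exists>s\<ge>0. s \<le> 1 \<and> max (- G (\<gamma> s)) (h (\<gamma> s)) = 0"
    by (rule IVT2') (use hq Gp Gq \<gamma>0 \<gamma>1 in \<open>auto intro!: continuous_intros G\<gamma> h\<gamma>\<close>)
  then obtain s where s: "max (- G (\<gamma> s)) (h (\<gamma> s)) = 0" by blast
  then have "G (\<gamma> s) > 0" "h (\<gamma> s) = 0"
    using h_pos[of s] by (cases "G (\<gamma> s) = 0"; auto simp: max_def split: if_splits)+
  then show "\<exists>w\<in>D. G w > 0 \<and> F w = c * G w"
    using \<gamma>D[of s] by (auto simp: h_def)
  have "\<exists>s\<ge>0. s \<le> 1 \<and> max (G (\<gamma> s)) (h (\<gamma> s)) = 0"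
    by (rule IVT') (use hp Gp Gq \<gamma>0 \<gamma>1 in \<open>auto intro!: continuous_intros G\<gamma> h\<gamma>\<close>)
  then obtain s where s: "max (G (\<gamma> s)) (h (\<gamma> s)) = 0" by blast
  then have "G (\<gamma> s) < 0" "h (\<gamma> s) = 0"
    using h_pos[of s] by (cases "G (\<gamma> s) = 0"; auto simp: max_def split: if_splits)+
  then show "\<exists>w\<in>D. G w < 0 \<and> F w = c * G w"
    using \<gamma>D[of s] by (auto simp: h_def)
qed

lemma slope_neg_le_slope_pos:
  assumes "p \<in> D" "q \<in> D" and Gp: "G p < 0" and Gq: "G q > 0"
  shows "F p / G p \<le> F q / G q"
proof (rule ccontr)
  assume "\<not> ?thesis"
  then obtain c where c: "F q / G q < c" "c < F p / G p"
    using dense[of "F q / G q" "F p / G p"] by auto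
  obtain d where d: "c < d" "d < F p / G p"
    using dense[OF c(2)] by auto
  then have d': "F q / G q < d" using c by linarith
  have "F q / G q \<ge> 0" using copositive[of q] assms by simp
  then have "c > 0" "d > 0" using c d' by linarith+
  then have "c = d"
    by (rule antipodal_slope_unique; intro slope_attained_on_both_sides[OF assms] c d d')
  then show False using d by simp
qed

text \<open>Written as the union of the pairs of opposite faces of a cube, each of them a product of compact
  sets.\<close>

definition sphere_max :: "(nat \<Rightarrow> real) set" where
  "sphere_max = (\<Union>i\<in>{..n}. PiE UNIV
     (\<lambda>j. if j = i then {-1, 1} else if j \<le> n then {-1..1} else {0}))"

lemma compact_sphere_max: "compact sphere_max"
proof -
  have "compact (PiE UNIV (\<lambda>j. if j = i then {-1, 1} else if j \<le> n then {-1..1} else {0::real}))"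
    for i :: nat
    unfolding compactin_euclidean_iff[symmetric] euclidean_product_topology[symmetric]
    by (subst compactin_PiE) auto
  then show ?thesis
    unfolding sphere_max_def by (intro compact_UN) auto
qed

lemma sphere_max_in_D: "w \<in> sphere_max \<Longrightarrow> w \<in> D"
proof -
  assume "w \<in> sphere_max"
  then obtain i where i: "i \<le> n"
    and w: "\<And>j. w j \<in> (if j = i then {-1, 1} else if j \<le> n then {-1..1} else {0})"
    unfolding sphere_max_def PiE_def Pi_def by auto
  have "w j = 0" if "j > n" for j
    using w[of j] that i by (auto split: if_splits)
  then show ?thesis by (simp add: D_def)
qed

lemma zero_notin_sphere_max: "(\<lambda>_. 0) \<notin> sphere_max"
  unfolding sphere_max_def PiE_def Pi_def by auto

lemma scale_to_sphere_max:
  assumes "w \<in> D" "w \<noteq> (\<lambda>_. 0)"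
  obtains r v where "r > 0" "v \<in> sphere_max" "w = (\<lambda>i. r * v i)"
proof -
  define r where "r = Max ((\<lambda>j. \<bar>w j\<bar>) ` {..n})"
  have le: "\<bar>w j\<bar> \<le> r" if "j \<le> n" for j
    unfolding r_def by (rule Max_ge) (use that in auto)
  have "r \<in> (\<lambda>j. \<bar>w j\<bar>) ` {..n}"
    unfolding r_def by (rule Max_in) auto
  then obtain i where i: "i \<le> n" "r = \<bar>w i\<bar>" by auto
  obtain j where "w j \<noteq> 0" using assms by auto
  moreover from this have "j \<le> n" using assms by (auto simp: D_def not_le)
  ultimately have r: "r > 0" using le[of j] by simp
  define v where "v = (\<lambda>i. w i / r)"
  have "v j \<in> (if j = i then {-1, 1} else if j \<le> n then {-1..1} else {0})" for j
    using i r le[of j] assms by (auto simp: v_def D_def abs_le_iff divide_simps abs_if)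
  then have "v \<in> sphere_max"
    unfolding sphere_max_def using i by (auto simp: PiE_def)
  moreover have "w = (\<lambda>i. r * v i)" using r by (simp add: v_def)
  ultimately show ?thesis using r that by blast
qed

theorem nonneg_combination: "\<exists>\<xi>\<ge>0. \<forall>w\<in>D. F w - \<xi> * G w \<ge> 0"
proof -
  define A where "A = sphere_max \<inter> {w. F w \<le> 0 \<and> G w \<le> 0}"
  have "closed {w. F w \<le> 0 \<and> G w \<le> 0}"
    by (intro closed_Collect_conj closed_Collect_le F_cont G_cont continuous_intros)
  then have A_compact: "compact A"
    unfolding A_def by (rule compact_Int_closed[OF compact_sphere_max])
  have A_D: "w \<in> D" if "w \<in> A" for w
    using that sphere_max_in_D by (simp add: A_def)
  have A_G: "G w < 0" if "w \<in> A" for w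
  proof -
    have "w \<noteq> (\<lambda>_. 0)" using that zero_notin_sphere_max by (auto simp: A_def)
    then show ?thesis
      using F_pos_where_G_zero[OF A_D[OF that]] that by (force simp: A_def)
  qed
  \<comment> \<open>Being attained in \<open>A\<close> is what makes \<open>\<xi>\<close> comparable with the slopes where \<open>G > 0\<close>.\<close>
  have "\<exists>\<xi>\<ge>0. (\<forall>w\<in>A. F w / G w \<le> \<xi>) \<and> (A \<noteq> {} \<longrightarrow> (\<exists>p\<in>A. \<xi> = F p / G p)) \<and> (A = {} \<longrightarrow> \<xi> = 0)"
  proof (cases "A = {}")
    case False
    have "continuous_on A (\<lambda>w. F w / G w)"
      by (intro continuous_intros continuous_on_subset[OF F_cont] continuous_on_subset[OF G_cont])
         (use A_G in force)+
    then obtain p where p: "p \<in> A" "\<And>w. w \<in> A \<Longrightarrow> F w / G w \<le> F p / G p"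
      using continuous_attains_sup[OF A_compact False] by blast
    have "F p / G p \<ge> 0"
      using p(1) by (simp add: A_def divide_nonpos_nonpos)
    then show ?thesis using p by blast
  qed auto
  then obtain \<xi> where \<xi>: "\<xi> \<ge> 0" and upper: "\<And>w. w \<in> A \<Longrightarrow> F w / G w \<le> \<xi>"
    and attained: "A \<noteq> {} \<Longrightarrow> \<exists>p\<in>A. \<xi> = F p / G p" and empty: "A = {} \<Longrightarrow> \<xi> = 0"
    by blast
  have sphere: "F v - \<xi> * G v \<ge> 0" if v: "v \<in> sphere_max" for v
  proof -
    note vD = sphere_max_in_D[OF v]
    consider "G v > 0" | "G v \<le> 0" "F v \<le> 0" | "G v \<le> 0" "F v > 0" by linarith
    then show ?thesis
    proof cases
      case 1
      have "\<xi> \<le> F v / G v"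
      proof (cases "A = {}")
        case True
        then show ?thesis using empty copositive[OF vD] 1 by simp
      next
        case False
        then obtain p where "p \<in> A" "\<xi> = F p / G p" using attained by blast
        then show ?thesis using slope_neg_le_slope_pos[OF A_D vD A_G 1] by simp
      qed
      then show ?thesis using 1 by (simp add: field_simps)
    next
      case 2
      then have "v \<in> A" using v by (simp add: A_def)
      from upper[OF this] A_G[OF this] show ?thesis by (simp add: field_simps)
    next
      case 3
      then have "\<xi> * G v \<le> 0" using \<xi> by (simp add: mult_nonneg_nonpos)
      then show ?thesis using 3 by simp
    qed
  qed
  have "F w - \<xi> * G w \<ge> 0" if w: "w \<in> D" for w
  proof (cases "w = (\<lambda>_. 0)")
    case True
    then show ?thesis by (simp add: F_zero G_zero)
  next
    case False
    obtain r v where r: "r > 0" and v: "v \<in> sphere_max" and weq: "w = (\<lambda>i. r * v i)"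
      using scale_to_sphere_max[OF w False] .
    have "F w - \<xi> * G w = r ^ k * (F v - \<xi> * G v)"
      unfolding weq F_scale G_scale by (simp add: algebra_simps)
    also have "\<dots> \<ge> 0" using r sphere[OF v] by simp
    finally show ?thesis .
  qed
  then show ?thesis using \<xi> by blast
qed

end

section \<open>Homogenizations of polynomials\<close>

lemma dim_semi_tensor_power [simp]: "dim_vec (semi_tensor_power x i) = dim_vec x ^ i"
  by (induction i) (simp_all add: semi_tensor_def mult.commute)

lemma semi_tensor_power_smult:
  "semi_tensor_power (r \<cdot>\<^sub>v x) i = r ^ i \<cdot>\<^sub>v semi_tensor_power x i"
proof (induction i)
  case 0
  then show ?case by (intro eq_vecI) auto
next
  case (Suc i)
  show ?case
  proof (intro eq_vecI)
    fix l assume "l < dim_vec (r ^ Suc i \<cdot>\<^sub>v semi_tensor_power x (Suc i))"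
    then have l: "l < dim_vec x ^ i * dim_vec x" by (simp add: semi_tensor_def)
    then have "dim_vec x > 0" by (cases "dim_vec x") auto
    then have "l div dim_vec x < dim_vec x ^ i" "l mod dim_vec x < dim_vec x"
      using l by (auto simp: less_mult_imp_div_less)
    then show "vec_index (semi_tensor_power (r \<cdot>\<^sub>v x) (Suc i)) l =
        vec_index (r ^ Suc i \<cdot>\<^sub>v semi_tensor_power x (Suc i)) l"
      using l by (simp add: Suc semi_tensor_def)
  qed (simp add: semi_tensor_def)
qed

lemma homogenization_smult:
  assumes "\<forall>i\<le>k. c i \<in> carrier_vec (dim_vec x ^ i)"
  shows "homogenization k c (r \<cdot>\<^sub>v x, r * t) = r ^ k * homogenization k c (x, t)"
proof -
  have "homogeneous_part c i (r \<cdot>\<^sub>v x) * (r * t) ^ (k - i) =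
      r ^ k * (homogeneous_part c i x * t ^ (k - i))" if "i \<le> k" for i
  proof -
    have "homogeneous_part c i (r \<cdot>\<^sub>v x) = r ^ i * homogeneous_part c i x"
      unfolding homogeneous_part_def semi_tensor_power_smult
      using assms that by (intro scalar_prod_smult_right) auto
    moreover have "r ^ k = r ^ i * r ^ (k - i)"
      using that by (simp flip: power_add)
    ultimately show ?thesis by (simp add: power_mult_distrib)
  qed
  then show ?thesis
    unfolding homogenization_def by (simp add: sum_distrib_left)
qed

lemma continuous_semi_tensor_power:
  "l < n ^ i \<Longrightarrow> continuous_on UNIV
     (\<lambda>w :: nat \<Rightarrow> real. vec_index (semi_tensor_power (Matrix.vec n w) i) l)"
proof (induction i arbitrary: l)
  case 0
  then show ?case by simp
next
  case (Suc i)
  then have l: "l < n ^ i * n" by (simp add: mult.commute)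
  then have "n > 0" by (cases n) auto
  then have "l div n < n ^ i" "l mod n < n"
    using l by (auto simp: less_mult_imp_div_less)
  then show ?case
    using l Suc.IH by (auto simp: semi_tensor_def intro!: continuous_intros continuous_on_product_coordinates)
qed

lemma continuous_homogenization:
  "continuous_on UNIV (\<lambda>w :: nat \<Rightarrow> real. homogenization k c (Matrix.vec n w, w n))"
  unfolding homogenization_def homogeneous_part_def scalar_prod_def
  by (auto intro!: continuous_intros continuous_on_product_coordinates continuous_semi_tensor_power)

lemma homogenization_at_1: "homogenization k c (x, 1) = polynomial_fun k c x"
  by (simp add: homogenization_def polynomial_fun_def)

section \<open>The copositivity theorem\<close>

theorem theorem2p7:
  fixes n k :: nat and fc gc :: "nat \<Rightarrow> real Matrix.vec"
  assumes "n \<ge> 1" and "k \<ge> 1"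
    and "coeffs_of_degree n k fc" and "coeffs_of_degree n k gc"
    and "copositive_with (carrier_vec n \<times> UNIV) (homogenization k fc) (homogenization k gc)"
    and "\<forall>y \<in> carrier_vec n \<times> UNIV.
           homogenization k fc y = 0 \<and> homogenization k gc y = 0 \<longrightarrow> y = (0\<^sub>v n, 0)"
    and "Uniq (\<lambda>(a :: real, b :: real).
           a\<^sup>2 + b\<^sup>2 = 1 \<and> a + delta a * b > 0 \<and>
           (\<exists>y \<in> carrier_vec n \<times> UNIV. homogenization k fc y = a \<and> homogenization k gc y = b) \<and>
           (\<exists>y \<in> carrier_vec n \<times> UNIV. homogenization k fc y = - a \<and> homogenization k gc y = - b))"
  shows "\<exists>\<xi> \<ge> 0. \<forall>x \<in> carrier_vec n. polynomial_fun k fc x - \<xi> * polynomial_fun k gc x \<ge> 0"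
proof -
  define F where "F w = homogenization k fc (Matrix.vec n w, w n)" for w :: "nat \<Rightarrow> real"
  define G where "G w = homogenization k gc (Matrix.vec n w, w n)" for w :: "nat \<Rightarrow> real"
  define D where "D = {w :: nat \<Rightarrow> real. \<forall>i>n. w i = 0}"
  have vec_scale: "Matrix.vec n (\<lambda>i. r * w i) = r \<cdot>\<^sub>v Matrix.vec n w" for r and w :: "nat \<Rightarrow> real"
    by (intro eq_vecI) auto
  have F_scale: "F (\<lambda>i. r * w i) = r ^ k * F w" for r w
    unfolding F_def vec_scale
    by (rule homogenization_smult) (use assms(3) in \<open>simp add: coeffs_of_degree_def\<close>)
  have G_scale: "G (\<lambda>i. r * w i) = r ^ k * G w" for r w
    unfolding G_def vec_scale
    by (rule homogenization_smult) (use assms(4) in \<open>simp add: coeffs_of_degree_def\<close>)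
  \<comment> \<open>A point of slope \<open>c\<close> can be rescaled to \<open>\<sigma> (c, 1)\<close> for any \<open>\<sigma>\<close> of the sign of its
      second component; the \<open>k\<close>-th root is taken of a positive number.\<close>
  have rescale: "\<exists>y \<in> carrier_vec n \<times> UNIV.
      homogenization k fc y = \<sigma> * c \<and> homogenization k gc y = \<sigma>"
    if "\<sigma> / G w > 0" "F w = c * G w" for \<sigma> c w
  proof -
    define r where "r = root k (\<sigma> / G w)"
    have "G w \<noteq> 0" using that(1) by auto
    moreover have "r ^ k = \<sigma> / G w"
      using that(1) assms(2) unfolding r_def by (intro real_root_pow_pos2) auto
    ultimately have "F (\<lambda>i. r * w i) = \<sigma> * c" "G (\<lambda>i. r * w i) = \<sigma>"
      unfolding F_scale G_scale using that(2) by simp_all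
    then show ?thesis unfolding F_def G_def by (intro bexI) auto
  qed
  define P where "P = (\<lambda>(a :: real, b :: real).
      a\<^sup>2 + b\<^sup>2 = 1 \<and> a + delta a * b > 0 \<and>
      (\<exists>y \<in> carrier_vec n \<times> UNIV. homogenization k fc y = a \<and> homogenization k gc y = b) \<and>
      (\<exists>y \<in> carrier_vec n \<times> UNIV. homogenization k fc y = - a \<and> homogenization k gc y = - b))"
  have uniq: "Uniq P" unfolding P_def by (rule assms(7))
  have P_slope: "P (1 / sqrt (1 + c\<^sup>2) * c, 1 / sqrt (1 + c\<^sup>2))"
    if c: "c > 0" and pos: "\<exists>w\<in>D. G w > 0 \<and> F w = c * G w"
      and neg: "\<exists>w\<in>D. G w < 0 \<and> F w = c * G w" for c
  proof -
    define \<sigma> where "\<sigma> = 1 / sqrt (1 + c\<^sup>2)"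
    have S: "1 + c\<^sup>2 > 0" by (rule add_pos_nonneg) auto
    then have \<sigma>: "\<sigma> > 0" by (simp add: \<sigma>_def)
    have "\<sigma>\<^sup>2 * (1 + c\<^sup>2) = 1"
      using S by (simp add: \<sigma>_def power_divide)
    then have "(\<sigma> * c)\<^sup>2 + \<sigma>\<^sup>2 = 1" by (simp add: algebra_simps power_mult_distrib)
    moreover have "\<sigma> * c + delta (\<sigma> * c) * \<sigma> > 0"
      using \<sigma> c by (simp add: delta_def)
    moreover have "\<exists>y \<in> carrier_vec n \<times> UNIV.
        homogenization k fc y = \<sigma> * c \<and> homogenization k gc y = \<sigma>"
      using pos \<sigma> by (elim bexE conjE, intro rescale) auto
    moreover have "\<exists>y \<in> carrier_vec n \<times> UNIV.
        homogenization k fc y = (- \<sigma>) * c \<and> homogenization k gc y = - \<sigma>"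
      using neg \<sigma> by (elim bexE conjE, intro rescale) (auto simp: divide_pos_neg divide_neg_pos)
    ultimately show ?thesis unfolding P_def \<sigma>_def by simp
  qed
  interpret copositive_homogeneous_pair n k F G D
  proof
    show "D = {w. \<forall>i>n. w i = 0}" by (rule D_def)
    show "k \<ge> 1" by (rule assms)
    show "F (\<lambda>i. r * w i) = r ^ k * F w" "G (\<lambda>i. r * w i) = r ^ k * G w" for r w
      by (rule F_scale G_scale)+
    show "continuous_on UNIV F" "continuous_on UNIV G"
      unfolding F_def G_def by (rule continuous_homogenization)+
    show "F w \<ge> 0" if "G w \<ge> 0" for w
      using assms(5) that unfolding copositive_with_def F_def G_def by auto
    show "w = (\<lambda>_. 0)" if w: "w \<in> D" "F w = 0" "G w = 0" for w
    proof
      have "(Matrix.vec n w, w n) \<in> carrier_vec n \<times> UNIV" by simp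
      then have "(Matrix.vec n w, w n) = (0\<^sub>v n, 0)"
        using assms(6) w(2,3) unfolding F_def G_def by blast
      then have eq: "Matrix.vec n w = 0\<^sub>v n" "w n = 0" by auto
      show "w i = 0" for i
      proof (cases i n rule: linorder_cases)
        case less
        then show ?thesis using arg_cong[OF eq(1), of "\<lambda>v. vec_index v i"] by simp
      qed (use eq(2) w(1) in \<open>auto simp: D_def\<close>)
    qed
    show "c = d" if "c > 0" "d > 0"
      "\<exists>w\<in>D. G w > 0 \<and> F w = c * G w" "\<exists>w\<in>D. G w < 0 \<and> F w = c * G w"
      "\<exists>w\<in>D. G w > 0 \<and> F w = d * G w" "\<exists>w\<in>D. G w < 0 \<and> F w = d * G w" for c d
    proof -
      have "(1 / sqrt (1 + c\<^sup>2) * c, 1 / sqrt (1 + c\<^sup>2)) = (1 / sqrt (1 + d\<^sup>2) * d, 1 / sqrt (1 + d\<^sup>2))"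
        by (rule Uniq_D[OF uniq P_slope P_slope]) (use that in auto)
      moreover have "1 / sqrt (1 + c\<^sup>2) \<noteq> 0"
        using add_pos_nonneg[of 1 "c\<^sup>2"] by simp
      ultimately show ?thesis by auto
    qed
  qed
  obtain \<xi> where \<xi>: "\<xi> \<ge> 0" and nonneg: "\<And>w. w \<in> D \<Longrightarrow> F w - \<xi> * G w \<ge> 0"
    using nonneg_combination by blast
  have "polynomial_fun k fc x - \<xi> * polynomial_fun k gc x \<ge> 0" if x: "x \<in> carrier_vec n" for x
  proof -
    define w where "w i = (if i < n then vec_index x i else if i = n then 1 else 0)" for i
    have "Matrix.vec n w = x" using x by (intro eq_vecI) (auto simp: w_def)
    moreover have "w n = 1" by (simp add: w_def)
    ultimately have "F w = polynomial_fun k fc x" "G w = polynomial_fun k gc x"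
      by (simp_all add: F_def G_def homogenization_at_1)
    moreover have "w \<in> D" by (simp add: D_def w_def)
    ultimately show ?thesis using nonneg by fastforce
  qed
  then show ?thesis using \<xi> by blast
qed

end
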